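(* Let $r,n\ge2$, $\pi=A_1\cdots A_n\in\mathbb{S}_{2rn}$ with $A_j=(2r(j-1)+1\ \cdots\ 2rj)$, $\mathcal{C}$ its conjugacy class, $\mu\in\{\epsilon,\mathrm{sgn}\}$, and let $\rho$ be a one-dimensional representation of $\mathbb{S}_{2rn}^\pi$ with $\rho(\pi)=-1$. (a) If $r$ is odd and $\rho=\chi_{r,\dots,r}\otimes\mu$, then the braiding of $M(\mathcal{C},\rho)$ is negative. (b) If $r$ is even and $\rho=\chi_{c,\dots,c}\otimes\mu$ with $c\in\{r/2,\,r,\,3r/2\}$, then the braiding of $M(\mathcal{C},\rho)$ is negative.
   Context: Permutations are composed right to left. For a finite group $G$, a conjugacy class $\mathcal{C}$, a fixed $s\in\mathcal{C}$ with centralizer $G^s$ and an irreducible representation $(\rho,V)$ of $G^s$, $M(\mathcal{C},\rho)$ is the irreducible Yetter–Drinfeld module over $\mathbb{C}G$: enumerate $\mathcal{C}=\{t_1=s,\dots,t_M\}$, choose $g_i\in G$ with $g_isg_i^{-1}=t_i$; $M(\mathcal{C},\rho)=\bigoplus_i g_i\otimes V$ with grading $\deg(g_i\otimes v)=t_i$, action $g\cdot(g_i\otimes v)=g_j\otimes\rho(\gamma)v$ where $gg_i=g_j\gamma$, $\gamma\in G^s$, and braiding $c((g_i\otimes v)\otimes(g_j\otimes w))=(g_h\otimes\rho(\gamma)w)\otimes(g_i\otimes v)$ where $t_ig_j=g_h\gamma$. When $\rho$ is one-dimensional, the braiding is called negative if for all $i,j$ with $t_it_j=t_jt_i$, setting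 $q_{ij}:=\rho(g_j^{-1}t_ig_j)$, one has $q_{ii}=-1$ and $q_{ij}q_{ji}=1$. Let $B_i$ ($1\le i\le n-1$) be the involution exchanging $2r(i-1)+m\leftrightarrow 2ri+m$ for $1\le m\le 2r$. Then $\mathbb{S}_{2rn}^\pi=\langle A_1,\dots,A_n\rangle\rtimes\langle B_1,\dots,B_{n-1}\rangle\cong\mathbb{Z}_{2r}^n\rtimes\mathbb{S}_n$, $B_i\mapsto(i\ i+1)$. With $\omega=e^{i\pi/r}$, $\chi_{c,\dots,c}\otimes\mu$ is the one-dimensional representation with $A_j\mapsto\omega^c$ for all $j$ and $B_i\mapsto\mu((i\ i+1))$, where $\epsilon,\mathrm{sgn}$ are the trivial and sign characters of $\mathbb{S}_n$. *)

theory Defs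
  imports Complex_Main "HOL-Combinatorics.Permutations"
begin

definition Sym :: "nat \<Rightarrow> (nat \<Rightarrow> nat) set" where
  "Sym N = {g. g permutes {1..N}}"

definition cycA :: "nat \<Rightarrow> nat \<Rightarrow> nat \<Rightarrow> nat" where
  "cycA r j k = (if 2*r*(j-1) + 1 \<le> k \<and> k < 2*r*j then k + 1
                 else if k = 2*r*j then 2*r*(j-1) + 1 else k)"

definition piperm :: "nat \<Rightarrow> nat \<Rightarrow> nat \<Rightarrow> nat" where
  "piperm r n = foldr (\<circ>) (map (cycA r) [1..<n+1]) id"

definition invB :: "nat \<Rightarrow> nat \<Rightarrow> nat \<Rightarrow> nat" where
  "invB r i k = (if 2*r*(i-1) + 1 \<le> k \<and> k \<le> 2*r*i then k + 2*r
                 else if 2*r*i + 1 \<le> k \<and> k \<le> 2*r*(i+1) then k - 2*r else k)"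

definition conj_class :: "nat \<Rightarrow> (nat \<Rightarrow> nat) \<Rightarrow> (nat \<Rightarrow> nat) set" where
  "conj_class N s = {g \<circ> s \<circ> inv g | g. g \<in> Sym N}"

definition centralizer :: "nat \<Rightarrow> (nat \<Rightarrow> nat) \<Rightarrow> (nat \<Rightarrow> nat) set" where
  "centralizer N s = {g \<in> Sym N. g \<circ> s = s \<circ> g}"

definition one_dim_rep :: "nat \<Rightarrow> (nat \<Rightarrow> nat) \<Rightarrow> ((nat \<Rightarrow> nat) \<Rightarrow> complex) \<Rightarrow> bool" where
  "one_dim_rep N s \<rho> \<longleftrightarrow>
     (\<forall>g \<in> centralizer N s. \<rho> g \<noteq> 0) \<and>
     (\<forall>g \<in> centralizer N s. \<forall>h \<in> centralizer N s. \<rho> (g \<circ> h) = \<rho> g * \<rho> h)"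

text \<open>A choice of representatives: for each t in the class, gsel t in S_N with
  gsel t s (gsel t)^{-1} = t (these are the g_i of the construction of M(C,rho)).\<close>
definition valid_choice :: "nat \<Rightarrow> (nat \<Rightarrow> nat) \<Rightarrow> ((nat \<Rightarrow> nat) \<Rightarrow> (nat \<Rightarrow> nat)) \<Rightarrow> bool" where
  "valid_choice N s gsel \<longleftrightarrow>
     (\<forall>t \<in> conj_class N s. gsel t \<in> Sym N \<and> gsel t \<circ> s \<circ> inv (gsel t) = t)"

definition qcoef :: "((nat \<Rightarrow> nat) \<Rightarrow> complex) \<Rightarrow> ((nat \<Rightarrow> nat) \<Rightarrow> (nat \<Rightarrow> nat))
                     \<Rightarrow> (nat \<Rightarrow> nat) \<Rightarrow> (nat \<Rightarrow> nat) \<Rightarrow> complex" where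
  "qcoef \<rho> gsel t u = \<rho> (inv (gsel u) \<circ> t \<circ> gsel u)"

definition negative_braiding :: "nat \<Rightarrow> (nat \<Rightarrow> nat) \<Rightarrow> ((nat \<Rightarrow> nat) \<Rightarrow> complex)
                                 \<Rightarrow> ((nat \<Rightarrow> nat) \<Rightarrow> (nat \<Rightarrow> nat)) \<Rightarrow> bool" where
  "negative_braiding N s \<rho> gsel \<longleftrightarrow>
     (\<forall>t \<in> conj_class N s. \<forall>u \<in> conj_class N s. t \<circ> u = u \<circ> t \<longrightarrow>
        qcoef \<rho> gsel t t = -1 \<and> qcoef \<rho> gsel t u * qcoef \<rho> gsel u t = 1)"

end

theory Submission
  imports Defs "HOL-Number_Theory.Cong" "HOL-Combinatorics.Cycles" "HOL-Combinatorics.Orbits"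
begin

text \<open>
  An element \<open>x\<close> of the centralizer of \<open>s = \<pi>\<close> permutes the \<open>n\<close> cycles of \<open>s\<close> by some \<open>\<sigma>\<close> and rotates
  the \<open>j\<close>-th one by some \<open>e j\<close>, so \<open>\<rho> x = \<mu> \<sigma> * \<zeta> ^ (\<Sum>j. e j)\<close> with \<open>\<zeta> = \<omega> ^ c\<close>. If \<open>t\<close> and \<open>u\<close> commute,
  the two coefficients are \<open>\<rho> x\<close> and \<open>\<rho> y\<close>, where \<open>x = h\<inverse> s h\<close> and \<open>y = h s h\<inverse>\<close> both
  centralize \<open>s\<close>. Consider an orbit of \<open>\<langle>s, x\<rangle>\<close> consisting of \<open>k\<close> cycles of \<open>s\<close>. On it
  \<open>x ^ k = s ^ e\<close> and, transporting the corresponding relation for \<open>y\<close> by \<open>h\<close>, \<open>s ^ k = x ^ f\<close>.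
  Minimality of \<open>k\<close> gives \<open>e = k a\<close> and \<open>f = k b\<close>, hence \<open>k \<equiv> k a b\<close> modulo \<open>2r\<close>; modulo a divisor
  \<open>d \<in> {2, 4}\<close> of \<open>2r\<close>, where the square of a unit is 1, this forces \<open>e + f \<equiv> 2k\<close>. Summing over the orbits, the
  exponents for \<open>x\<close> and \<open>y\<close> add up to \<open>2n\<close> modulo \<open>d\<close>. Since \<open>\<zeta>\<close> is a \<open>d\<close>-th root of unity and
  \<open>\<zeta> ^ n = \<rho> \<pi> = -1\<close>, the powers of \<open>\<zeta>\<close> multiply to 1. The signs cancel because
  the cycles of both block permutations correspond to the orbits of \<open>\<langle>s, x\<rangle>\<close>.
\<close>

section \<open>The sign of a permutation and its number of orbits\<close>

lemma sign_cycle_of_list: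
  "distinct cs \<Longrightarrow> cs \<noteq> [] \<Longrightarrow> sign (cycle_of_list cs) = (-1) ^ (length cs - 1)"
proof (induction cs rule: cycle_of_list.induct)
  case (1 i j cs)
  moreover have "sign (cycle_of_list (i # j # cs))
      = sign (transpose i j) * sign (cycle_of_list (j # cs))"
    unfolding cycle_of_list.simps by (intro sign_compose permutation_swap_id permutation_of_cycle)
  ultimately show ?case
    by (simp add: sign_swap_id del: cycle_of_list.simps)
qed auto

text \<open>Applying the cycle \<open>n\<close> times to every entry rotates the list by
  \<open>n\<close>. Comparing heads shows that the iterates of \<open>hd cs\<close> run through all
  entries, and any other entry has the same orbit.\<close>

lemma orbit_cycle_of_list:
  assumes "distinct cs" "x \<in> set cs"
  shows "orbit (cycle_of_list cs) x = set cs"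
proof -
  have "cs \<noteq> []" using assms(2) by auto
  have "(cycle_of_list cs ^^ n) (hd cs) = cs ! (n mod length cs)" for n
  proof -
    have "(cycle_of_list cs ^^ n) (hd cs) = hd (map (cycle_of_list cs ^^ n) cs)"
      using \<open>cs \<noteq> []\<close> by (simp add: hd_map)
    also have "\<dots> = hd (rotate n cs)"
      using cyclic_rotation[OF assms(1)] by simp
    also have "\<dots> = cs ! (n mod length cs)"
      using \<open>cs \<noteq> []\<close> by (rule hd_rotate_conv_nth)
    finally show ?thesis .
  qed
  then have "orbit (cycle_of_list cs) (hd cs) = {cs ! (n mod length cs) | n. True}"
    by (simp add: orbit_altdef_permutation[OF permutation_of_cycle])
  also have "\<dots> = set cs"
    using \<open>cs \<noteq> []\<close> by (auto simp: set_conv_nth) (metis mod_less)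
  finally show ?thesis
    using assms(2) by (metis orbit_cyclic_eq3 cyclic_on_def cyclic_on_orbit' permutation_of_cycle)
qed

text \<open>Each nonempty cycle of a decomposition adds its length to the number of points, one to
  the number of orbits, and a factor -1 to the power length minus one to the sign. Fixed points in
  \<open>S\<close> count as orbits of size one.\<close>

lemma sign_card_orbits:
  assumes "p permutes S" "finite S"
  shows "sign p = (-1) ^ (card S + card (orbit p ` S))"
proof -
  have "p permutes S \<and> finite S \<and> sign p = (-1) ^ (card S + card (orbit p ` S))"
    if "cycle_decomp S p" for S :: "'a set" and p
    using that
  proof induction
    case empty
    then show ?case by (simp add: id_def[symmetric])
  next
    case (comp I p cs)
    define c where "c = cycle_of_list cs"
    have c: "c permutes set cs" unfolding c_def by (rule cycle_permutes)
    have p: "p permutes I" "finite I" using comp by auto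
    have cp: "c \<circ> p permutes set cs \<union> I"
      using c p by (metis permutes_compose permutes_subset sup_ge1 sup_ge2)
    have sign_cp: "sign (c \<circ> p) = sign c * sign p"
      using c p by (intro sign_compose) (auto simp: c_def permutation_of_cycle permutation_permutes)
    have joint_orbit1: "orbit (c \<circ> p) x = orbit p x" if "x \<in> I" for x
    proof -
      have "c (p y) = p y" if "y \<in> I" for y
        using that permutes_in_image[OF p(1)] comp(3) permutes_not_in[OF c] by blast
      then show ?thesis
        using that permutes_in_image[OF p(1)] by (intro orbit_cong0[of x I]) auto
    qed
    have joint_orbit2: "orbit (c \<circ> p) x = set cs" if "x \<in> set cs" for x
    proof -
      have "orbit (c \<circ> p) x = orbit c x"
        using that permutes_in_image[OF c] comp(3) permutes_not_in[OF p(1)]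
        by (intro orbit_cong0[of x "set cs"]) (auto simp: disjoint_iff)
      then show ?thesis using orbit_cycle_of_list[OF comp(2) that] c_def by simp
    qed
    show ?case
    \<comment> \<open>The empty list adds no orbit, and \<open>length cs - 1\<close> would be
      truncated there.\<close>
    proof (cases "cs = []")
      case True
      then show ?thesis using comp by simp
    next
      case False
      have disj: "set cs \<notin> orbit p ` I"
      proof
        assume "set cs \<in> orbit p ` I"
        then obtain x where "x \<in> I" "set cs = orbit p x" by auto
        then show False
          using permutes_orbit_subset[OF p(1), of x] False comp(3) by (metis Int_absorb2 set_empty)
      qed
      have "orbit (c \<circ> p) ` (set cs \<union> I) = insert (set cs) (orbit p ` I)"
      proof -
        have "orbit (c \<circ> p) ` set cs = {set cs}"
          using joint_orbit2 hd_in_set[OF False] by (auto simp: image_iff)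
        moreover have "orbit (c \<circ> p) ` I = orbit p ` I"
          using joint_orbit1 by (intro image_cong) auto
        ultimately show ?thesis by (simp add: image_Un)
      qed
      then have "card (orbit (c \<circ> p) ` (set cs \<union> I)) = Suc (card (orbit p ` I))"
        using disj p(2) by simp
      moreover have "card (set cs \<union> I) = length cs + card I"
        using comp(2,3) p(2) by (simp add: card_Un_disjoint distinct_card)
      moreover have "sign c = (-1) ^ (length cs - 1)"
        unfolding c_def using sign_cycle_of_list[OF comp(2) False] .
      \<comment> \<open>Raising the exponent by two removes the subtraction:
        \<open>Suc (length cs)\<close> counts the new points together with the one new
        orbit.\<close>
      moreover have "(-1) ^ (length cs - 1) = (-1 :: int) ^ (Suc (length cs))"
        using False by (cases cs) auto
      ultimately have "sign (c \<circ> p)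
          = (-1) ^ (card (set cs \<union> I) + card (orbit (c \<circ> p) ` (set cs \<union> I)))"
        unfolding sign_cp using comp by (simp only: power_add power_Suc)
      then show ?thesis using cp p(2) unfolding c_def by blast
    qed
  qed
  then show ?thesis using cycle_decomposition[OF assms] by blast
qed

section \<open>Block permutations with rotations\<close>

text \<open>
  A point of \<open>{1..m*n}\<close> is encoded by the index of its block, counted from 1, and its offset in the
  block, counted from 0.
\<close>
definition block :: "nat \<Rightarrow> nat \<Rightarrow> nat" where
  "block m p = (p - 1) div m + 1"

definition offset :: "nat \<Rightarrow> nat \<Rightarrow> nat" where
  "offset m p = (p - 1) mod m"

definition point :: "nat \<Rightarrow> nat \<Rightarrow> nat \<Rightarrow> nat" where
  "point m j q = m * (j - 1) + q + 1"

text \<open>These are the elements of the wreath product of the integers modulo \<open>m\<close>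
  with the symmetric group on \<open>n\<close> letters. The rotation is indexed by the source block,
  and \<open>e\<close> has natural values, so exponents matter only modulo \<open>m\<close>.\<close>

definition block_perm :: "nat \<Rightarrow> nat \<Rightarrow> (nat \<Rightarrow> nat) \<Rightarrow> (nat \<Rightarrow> nat) \<Rightarrow> nat \<Rightarrow> nat" where
  "block_perm m n \<sigma> e p =
     (if p \<in> {1..m*n} then point m (\<sigma> (block m p)) ((offset m p + e (block m p)) mod m) else p)"

definition shift :: "nat \<Rightarrow> nat \<Rightarrow> nat \<Rightarrow> nat" where
  "shift m n = block_perm m n id (\<lambda>_. 1)"

lemma block_point [simp]: "q < m \<Longrightarrow> j \<ge> 1 \<Longrightarrow> block m (point m j q) = j"
  by (simp add: block_def point_def)

lemma offset_point [simp]: "q < m \<Longrightarrow> offset m (point m j q) = q"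
  by (simp add: offset_def point_def)

lemma point_block_offset [simp]: "p \<ge> 1 \<Longrightarrow> point m (block m p) (offset m p) = p"
  by (simp add: block_def offset_def point_def)

lemma block_mem: "p \<in> {1..m*n} \<Longrightarrow> block m p \<in> {1..n}"
proof -
  assume p: "p \<in> {1..m*n}"
  then have "p - 1 < n * m" by (auto simp: mult.commute)
  then have "(p - 1) div m < n" by (rule less_mult_imp_div_less)
  then show ?thesis by (simp add: block_def)
qed

lemma offset_less: "m > 0 \<Longrightarrow> offset m p < m"
  by (simp add: offset_def)

lemma point_mem:
  assumes "j \<in> {1..n}" "q < m"
  shows "point m j q \<in> {1..m*n}"
proof -
  have "m * (j - 1) + q < m * (j - 1) + m" using assms by simp
  also have "\<dots> = m * j" using assms by (cases j) auto
  also have "\<dots> \<le> m * n" using assms by simp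
  finally show ?thesis by (simp add: point_def)
qed

lemma eq_blockI:
  assumes "p \<in> {1..m*n}" "p' \<in> {1..m*n}" "block m p = block m p'" "offset m p = offset m p'"
  shows "p = p'"
  using point_block_offset[of p m] point_block_offset[of p' m] assms by auto

lemma block_perm_mem:
  assumes "m > 0" "\<sigma> ` {1..n} \<subseteq> {1..n}" "p \<in> {1..m*n}"
  shows "block_perm m n \<sigma> e p \<in> {1..m*n}"
    and "block m (block_perm m n \<sigma> e p) = \<sigma> (block m p)"
    and "offset m (block_perm m n \<sigma> e p) = (offset m p + e (block m p)) mod m"
proof -
  have "\<sigma> (block m p) \<in> {1..n}" using block_mem[OF assms(3)] assms(2) by blast
  then show "block_perm m n \<sigma> e p \<in> {1..m*n}"
    and "block m (block_perm m n \<sigma> e p) = \<sigma> (block m p)"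
    and "offset m (block_perm m n \<sigma> e p) = (offset m p + e (block m p)) mod m"
    using assms(1,3) point_mem[of "\<sigma> (block m p)" n _ m] by (auto simp: block_perm_def)
qed

lemma block_perm_outside: "p \<notin> {1..m*n} \<Longrightarrow> block_perm m n \<sigma> e p = p"
  by (simp only: block_perm_def if_False)

lemma eq_monI:
  assumes "m > 0" "\<sigma> ` {1..n} \<subseteq> {1..n}"
    and "\<And>p. p \<notin> {1..m*n} \<Longrightarrow> g p = p"
    and "\<And>p. p \<in> {1..m*n} \<Longrightarrow> g p \<in> {1..m*n}"
    and "\<And>p. p \<in> {1..m*n} \<Longrightarrow> block m (g p) = \<sigma> (block m p)"
    and "\<And>p. p \<in> {1..m*n} \<Longrightarrow> offset m (g p) = (offset m p + e (block m p)) mod m"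
  shows "g = block_perm m n \<sigma> e"
proof
  fix p
  show "g p = block_perm m n \<sigma> e p"
  proof (cases "p \<in> {1..m*n}")
    case True
    show ?thesis
      by (rule eq_blockI[OF assms(4)[OF True] block_perm_mem(1)[OF assms(1,2) True]])
         (simp_all only: block_perm_mem(2,3)[OF assms(1,2) True] assms(5,6)[OF True])
  next
    case False
    then show ?thesis using assms(3) block_perm_outside by metis
  qed
qed

text \<open>This is the multiplication law of the wreath product: the outer factor rotates the block
  that \<open>\<tau>\<close> has reached, hence \<open>e (\<tau> j)\<close>.\<close>

lemma block_perm_comp:
  assumes "m > 0" "\<sigma> ` {1..n} \<subseteq> {1..n}" "\<tau> ` {1..n} \<subseteq> {1..n}"
  shows "block_perm m n \<sigma> e \<circ> block_perm m n \<tau> f = block_perm m n (\<sigma> \<circ> \<tau>) (\<lambda>j. f j + e (\<tau> j))"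
proof (rule eq_monI)
  show "(\<sigma> \<circ> \<tau>) ` {1..n} \<subseteq> {1..n}" using assms by fastforce
  fix p assume p: "p \<in> {1..m*n}"
  note A = block_perm_mem[OF assms(1,3) p, of f]
  note B = block_perm_mem[OF assms(1,2) A(1), of e]
  show "(block_perm m n \<sigma> e \<circ> block_perm m n \<tau> f) p \<in> {1..m*n}" using B by simp
  show "block m ((block_perm m n \<sigma> e \<circ> block_perm m n \<tau> f) p) = (\<sigma> \<circ> \<tau>) (block m p)" using A B by simp
  show "offset m ((block_perm m n \<sigma> e \<circ> block_perm m n \<tau> f) p) = (offset m p + (f (block m p) + e (\<tau> (block m p)))) mod m"
    using A B by (simp add: mod_simps add.assoc)
next
  fix p assume "p \<notin> {1..m*n}"
  then show "(block_perm m n \<sigma> e \<circ> block_perm m n \<tau> f) p = p" by (metis comp_apply block_perm_outside)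
qed (rule assms(1))

lemma block_perm_permutes:
  assumes "m > 0" "\<sigma> permutes {1..n}"
  shows "block_perm m n \<sigma> e permutes {1..m*n}"
proof (rule bij_imp_permutes)
  have im: "\<sigma> ` {1..n} \<subseteq> {1..n}" using permutes_image[OF assms(2)] by simp
  have "inj_on (block_perm m n \<sigma> e) {1..m*n}"
  proof (rule inj_onI)
    fix p p' assume p: "p \<in> {1..m*n}" and p': "p' \<in> {1..m*n}"
      and eq: "block_perm m n \<sigma> e p = block_perm m n \<sigma> e p'"
    have b: "block m p = block m p'"
      using block_perm_mem(2)[OF assms(1) im p, of e] block_perm_mem(2)[OF assms(1) im p', of e] eq
        permutes_inj[OF assms(2)] by (metis injD)
    have "[offset m p + e (block m p) = offset m p' + e (block m p)] (mod m)"
      using block_perm_mem(3)[OF assms(1) im p, of e] block_perm_mem(3)[OF assms(1) im p', of e] eq b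
      by (simp add: cong_def)
    then have "offset m p = offset m p'"
      using offset_less[OF assms(1)] by (simp add: cong_add_rcancel_nat cong_less_modulus_unique_nat)
    then show "p = p'" using b eq_blockI p p' by blast
  qed
  moreover from this have "block_perm m n \<sigma> e ` {1..m*n} = {1..m*n}"
    using block_perm_mem(1)[OF assms(1) im] by (intro endo_inj_surj) (blast intro: finite_atLeastAtMost)+
  ultimately show "bij_betw (block_perm m n \<sigma> e) {1..m*n} {1..m*n}"
    unfolding bij_betw_def by (rule conjI)
qed (rule block_perm_outside)

section \<open>The permutations A_j, B_i and their product \<pi> in block coordinates\<close>

lemma cycA_eq_block_perm:
  assumes "r > 0" "j \<in> {1..n}"
  shows "cycA r j = block_perm (2*r) n id (\<lambda>i. if i = j then 1 else 0)"
proof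
  fix p
  have jn: "2*r*j \<le> 2*r*n" using assms by simp
  consider "p \<notin> {1..2*r*n}" | "p \<in> {1..2*r*n}" "block (2*r) p = j"
    | "p \<in> {1..2*r*n}" "block (2*r) p \<noteq> j" by auto
  then show "cycA r j p = block_perm (2*r) n id (\<lambda>i. if i = j then 1 else 0) p"
  proof cases
    case 1
    then have "p = 0 \<or> p > 2*r*j" using jn by (meson atLeastAtMost_iff le_trans not_le less_one)
    moreover have "2*r*j > 0" using assms by auto
    ultimately show ?thesis unfolding block_perm_outside[OF 1] cycA_def by auto
  next
    case 2
    define q where "q = offset (2*r) p"
    have p: "p = 2*r*(j-1) + q + 1"
      using point_block_offset[of p "2*r"] 2 by (simp add: point_def q_def)
    have q: "q < 2*r" using offset_less assms by (simp add: q_def)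
    have j: "2*r*j = 2*r*(j-1) + 2*r" using assms by (cases j) auto
    have "block_perm (2*r) n id (\<lambda>i. if i = j then 1 else 0) p = point (2*r) j ((q + 1) mod (2*r))"
      using 2 by (simp add: block_perm_def q_def)
    moreover have "cycA r j p = point (2*r) j ((q + 1) mod (2*r))"
    proof (cases "q + 1 < 2*r")
      case True
      then show ?thesis unfolding p cycA_def point_def using j by simp
    next
      case False
      then have "q + 1 = 2*r" using q by simp
      then show ?thesis unfolding p cycA_def point_def using j by simp
    qed
    ultimately show ?thesis by simp
  next
    case 3
    have "\<not> (2*r*(j-1) + 1 \<le> p \<and> p \<le> 2*r*j)"
    proof
      assume a: "2*r*(j-1) + 1 \<le> p \<and> p \<le> 2*r*j"
      define q where "q = p - 1 - 2*r*(j-1)"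
      have j: "2*r*j = 2*r*(j-1) + 2*r" using assms by (cases j) auto
      have "p = point (2*r) j q" "q < 2*r" using a j assms by (auto simp: q_def point_def)
      then show False using 3 assms by auto
    qed
    moreover have "2*r*(j-1) + 1 \<le> 2*r*j" using assms by (cases j) auto
    moreover have "block_perm (2*r) n id (\<lambda>i. if i = j then 1 else 0) p = p"
      using 3 offset_less[of "2*r" p] assms by (auto simp: block_perm_def)
    ultimately show ?thesis by (auto simp: cycA_def)
  qed
qed

lemma invB_eq_block_perm:
  assumes "r > 0" "i \<in> {1..n-1}"
  shows "invB r i = block_perm (2*r) n (transpose i (i+1)) (\<lambda>_. 0)"
proof
  fix p
  have jn: "2*r*(i+1) \<le> 2*r*n" using assms by (intro mult_le_mono) auto
  have i2: "2*r*(i+1) = 2*r*i + 2*r" "2*r*i = 2*r*(i-1) + 2*r" using assms by (cases i; simp)+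
  show "invB r i p = block_perm (2*r) n (transpose i (i+1)) (\<lambda>_. 0) p"
  proof (cases "p \<in> {1..2*r*n}")
    case False
    then have "p = 0 \<or> p > 2*r*(i+1)" using jn by auto
    then show ?thesis unfolding block_perm_outside[OF False] invB_def using i2 by auto
  next
    case True
    define q b where "q = offset (2*r) p" and "b = block (2*r) p"
    have p: "p = point (2*r) b q" using True by (simp add: q_def b_def)
    have q: "q < 2*r" using offset_less assms by (simp add: q_def)
    have b: "b \<ge> 1" by (simp add: b_def block_def)
    have *: "block_perm (2*r) n (transpose i (i+1)) (\<lambda>_. 0) p = point (2*r) (transpose i (i+1) b) q"
      using True q by (simp add: block_perm_def q_def b_def)
    consider "b = i" | "b = i + 1" | "b < i" | "b > i + 1" by linarith
    then show ?thesis
    proof cases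
      case 1
      then show ?thesis unfolding * unfolding p using q i2 by (simp add: point_def invB_def)
    next
      case 2
      then show ?thesis unfolding * unfolding p using q i2 by (simp add: point_def invB_def)
    next
      case 3
      then have "2*r*b \<le> 2*r*(i-1)" "2*r*b = 2*r*(b-1) + 2*r"
        using b by (auto intro!: mult_le_mono) (cases b; simp)
      then have "p \<le> 2*r*(i-1)" unfolding p point_def using q by linarith
      then have "invB r i p = p" using i2 by (simp add: invB_def)
      then show ?thesis unfolding * using 3 p by (simp add: transpose_def)
    next
      case 4
      then have "2*r*(i+1) \<le> 2*r*(b-1)" by (intro mult_le_mono) auto
      then have "p > 2*r*(i+1)" unfolding p point_def by linarith
      then have "invB r i p = p" using i2 by (simp add: invB_def)
      then show ?thesis unfolding * using 4 p by (simp add: transpose_def)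
    qed
  qed
qed

lemma block_perm_id: "m > 0 \<Longrightarrow> block_perm m n id (\<lambda>_. 0) = id"
  by (rule eq_monI[symmetric]) (auto simp: offset_less)

lemma piperm_eq_shift:
  assumes "r > 0"
  shows "piperm r n = shift (2*r) n"
proof -
  have m: "2*r > 0" using assms by simp
  \<comment> \<open>The recursion of \<open>foldr\<close> peels off the first factor, whereas the
    induction on \<open>k\<close> appends the last one.\<close>
  have foldr_o: "foldr (\<circ>) (xs :: (nat \<Rightarrow> nat) list) g = foldr (\<circ>) xs id \<circ> g" for xs g
    by (induction xs) (auto simp: o_assoc)
  have "foldr (\<circ>) (map (cycA r) [1..<k+1]) id = block_perm (2*r) n id (\<lambda>i. if i \<le> k \<and> i \<ge> 1 then 1 else 0)"
    if "k \<le> n" for k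
    using that
  proof (induction k)
    case 0
    have "(\<lambda>i::nat. if i \<le> 0 \<and> i \<ge> 1 then 1 else 0 :: nat) = (\<lambda>_. 0)" by auto
    then show ?case using block_perm_id[OF m, of n] by (simp only:) simp
  next
    case (Suc k)
    have "foldr (\<circ>) (map (cycA r) [1..<Suc k+1]) id
        = foldr (\<circ>) (map (cycA r) [1..<k+1]) id \<circ> cycA r (Suc k)"
      by (simp add: foldr_o[of _ "cycA r (Suc k)"])
    also have "\<dots> = block_perm (2*r) n id (\<lambda>i. if i \<le> k \<and> i \<ge> 1 then 1 else 0)
         \<circ> block_perm (2*r) n id (\<lambda>i. if i = Suc k then 1 else 0)"
    proof -
      have "Suc k \<in> {1..n}" using Suc.prems by simp
      then show ?thesis
        using Suc.prems by (simp only: cycA_eq_block_perm[OF assms] Suc.IH[OF Suc_leD])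
    qed
    also have "\<dots> = block_perm (2*r) n id (\<lambda>i. if i \<le> Suc k \<and> i \<ge> 1 then 1 else 0)"
      by (subst block_perm_comp[OF m]) (auto intro!: arg_cong[of _ _ "block_perm (2*r) n id"])
    finally show ?case .
  qed
  from this[of n] have "piperm r n = block_perm (2*r) n id (\<lambda>i. if i \<le> n \<and> i \<ge> 1 then 1 else 0)"
    by (simp add: piperm_def)
  \<comment> \<open>The two exponent functions differ only at indices outside \<open>{1..n}\<close>,
    which no block has.\<close>
  also have "\<dots> = shift (2*r) n"
    using block_mem[of _ "2*r" n] by (auto simp: shift_def block_perm_def fun_eq_iff)
  finally show ?thesis .
qed

lemma block_perm_cong:
  "(\<And>j. j \<in> {1..n} \<Longrightarrow> \<sigma> j = \<tau> j) \<Longrightarrow> (\<And>j. j \<in> {1..n} \<Longrightarrow> e j = f j) \<Longrightarrow>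
   block_perm m n \<sigma> e = block_perm m n \<tau> f"
  using block_mem[of _ m n] by (simp add: block_perm_def fun_eq_iff)

section \<open>One-dimensional representations of the centralizer\<close>

lemma permutes_image_subset: "\<sigma> permutes S \<Longrightarrow> \<sigma> ` S \<subseteq> S"
  by (simp add: permutes_image)

text \<open>A point starting in block \<open>j\<close> visits the blocks
  \<open>(\<sigma> ^^ l) j\<close> in turn and collects the rotation of each.\<close>

lemma block_perm_funpow:
  assumes "m > 0" "\<sigma> permutes {1..n}"
  shows "block_perm m n \<sigma> e ^^ i = block_perm m n (\<sigma> ^^ i) (\<lambda>j. \<Sum>l<i. e ((\<sigma> ^^ l) j))"
proof (induction i)
  case 0
  then show ?case
    by (simp only: funpow.simps(1) lessThan_0 sum.empty block_perm_id[OF assms(1)])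
next
  case (Suc i)
  have "\<sigma> ^^ i permutes {1..n}" using assms(2) by (rule permutes_funpow)
  then have "block_perm m n \<sigma> e \<circ> block_perm m n (\<sigma> ^^ i) (\<lambda>j. \<Sum>l<i. e ((\<sigma> ^^ l) j))
      = block_perm m n (\<sigma> \<circ> \<sigma> ^^ i) (\<lambda>j. (\<Sum>l<i. e ((\<sigma> ^^ l) j)) + e ((\<sigma> ^^ i) j))"
    using assms by (intro block_perm_comp permutes_image_subset)
  then show ?case
    by (simp only: funpow.simps(2) Suc.IH sum.lessThan_Suc)
qed

lemma shift_funpow:
  assumes "m > 0"
  shows "shift m n ^^ i = block_perm m n id (\<lambda>_. i)"
  using block_perm_funpow[OF assms permutes_id, where e = "\<lambda>_. 1"] by (simp add: shift_def)

lemma block_perm_commutes_shift: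
  assumes "m > 0" "\<sigma> permutes {1..n}"
  shows "block_perm m n \<sigma> e \<circ> shift m n = shift m n \<circ> block_perm m n \<sigma> e"
  unfolding shift_def using assms by (simp add: block_perm_comp permutes_image_subset)

lemma block_perm_in_centralizer:
  assumes "r > 0" "\<sigma> permutes {1..n}"
  shows "block_perm (2*r) n \<sigma> e \<in> centralizer (2*r*n) (piperm r n)"
  using block_perm_permutes[of "2*r" \<sigma> n e] block_perm_commutes_shift[of "2*r" \<sigma> n e] assms
  by (simp add: centralizer_def Sym_def piperm_eq_shift)

text \<open>The shift is transitive on each block, so a permutation commuting with it is determined
  by its values at the points of offset 0.\<close>

lemma centralizer_eq_block_perm:
  assumes "r > 0" "g \<in> centralizer (2*r*n) (piperm r n)"
  obtains \<sigma> e where "\<sigma> permutes {1..n}" "g = block_perm (2*r) n \<sigma> e"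
proof -
  define m where "m = 2*r"
  have m: "m > 0" using assms by (simp add: m_def)
  define s where "s = shift m n"
  have g: "g permutes {1..m*n}" and comm: "g \<circ> s = s \<circ> g"
    using assms piperm_eq_shift[OF assms(1)] by (auto simp: centralizer_def Sym_def m_def s_def)
  \<comment> \<open>The image of the first point of block \<open>j\<close> yields the target block
    and the rotation. Off \<open>{1..n}\<close> the map is the identity, as \<open>permutes\<close>
    demands.\<close>
  define \<sigma> where "\<sigma> j = (if j \<in> {1..n} then block m (g (point m j 0)) else j)" for j
  define e where "e j = offset m (g (point m j 0))" for j
  have g0: "g (point m j 0) \<in> {1..m*n}" if "j \<in> {1..n}" for j
    using point_mem[OF that m] permutes_in_image[OF g] by blast
  have g_eq: "block m (g p) = \<sigma> (block m p) \<and> offset m (g p) = (offset m p + e (block m p)) mod m"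
    if p: "p \<in> {1..m*n}" for p
  proof -
    define j q where "j = block m p" and "q = offset m p"
    have j: "j \<in> {1..n}" using block_mem[OF p] by (simp add: j_def)
    have q: "q < m" using offset_less[OF m] by (simp add: q_def)
    have "p = block_perm m n id (\<lambda>_. q) (point m j 0)"
      using point_mem[OF j m] m j q p by (simp add: block_perm_def) (simp add: j_def q_def)
    then have "g p = g ((s ^^ q) (point m j 0))" by (simp only: s_def shift_funpow[OF m])
    also have "g ((s ^^ q) z) = (s ^^ q) (g z)" for z
      using comm by (induction q) (auto simp: fun_eq_iff)
    finally have "g p = block_perm m n id (\<lambda>_. q) (g (point m j 0))" by (simp only: s_def shift_funpow[OF m])
    then show ?thesis
      using block_perm_mem(2,3)[of m id n "g (point m j 0)" "\<lambda>_. q"] g0[OF j] m j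
      by (simp add: \<sigma>_def e_def add.commute j_def q_def)
  qed
  \<comment> \<open>Pulling \<open>point m i 0\<close> back along \<open>g\<close> shows that every
    \<open>i\<close> is attained; finiteness then gives injectivity.\<close>
  have "\<sigma> ` {1..n} = {1..n}"
  proof
    show "\<sigma> ` {1..n} \<subseteq> {1..n}" using block_mem[OF g0] by (auto simp: \<sigma>_def)
    show "{1..n} \<subseteq> \<sigma> ` {1..n}"
    proof
      fix i assume i: "i \<in> {1..n}"
      obtain p where p: "p \<in> {1..m*n}" "g p = point m i 0"
        using point_mem[OF i m] permutes_image[OF g] by (metis imageE)
      then have "\<sigma> (block m p) = i" using g_eq[OF p(1)] i m by simp
      then show "i \<in> \<sigma> ` {1..n}" using block_mem[OF p(1)] by blast
    qed
  qed
  then have \<sigma>: "\<sigma> permutes {1..n}"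
    by (intro bij_imp_permutes bij_betw_imageI eq_card_imp_inj_on) (auto simp: \<sigma>_def)
  have "g = block_perm m n \<sigma> e"
    by (rule eq_monI[OF m permutes_image_subset[OF \<sigma>]])
       (use g_eq permutes_not_in[OF g] permutes_in_image[OF g] in blast)+
  then show thesis using that \<sigma> m_def by blast
qed

lemma one_dim_rep_block_perm_comp:
  fixes \<rho> :: "(nat \<Rightarrow> nat) \<Rightarrow> complex"
  assumes "r > 0" "one_dim_rep (2*r*n) (piperm r n) \<rho>" "\<sigma> permutes {1..n}" "\<tau> permutes {1..n}"
  shows "\<rho> (block_perm (2*r) n (\<sigma> \<circ> \<tau>) (\<lambda>j. f j + e (\<tau> j)))
    = \<rho> (block_perm (2*r) n \<sigma> e) * \<rho> (block_perm (2*r) n \<tau> f)"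
proof -
  have "block_perm (2*r) n (\<sigma> \<circ> \<tau>) (\<lambda>j. f j + e (\<tau> j)) = block_perm (2*r) n \<sigma> e \<circ> block_perm (2*r) n \<tau> f"
    using assms by (intro block_perm_comp[symmetric] permutes_image_subset) auto
  moreover have "\<rho> (block_perm (2*r) n \<sigma> e \<circ> block_perm (2*r) n \<tau> f) = \<rho> (block_perm (2*r) n \<sigma> e) * \<rho> (block_perm (2*r) n \<tau> f)"
    using assms(2) block_perm_in_centralizer[OF assms(1,3)] block_perm_in_centralizer[OF assms(1,4)]
    unfolding one_dim_rep_def by blast
  ultimately show ?thesis by (simp only:)
qed

section \<open>Values of a one-dimensional representation\<close>

text \<open>The hypothesis covers adjacent transpositions only. Induction on the distance conjugates
  by an adjacent one, which multiplies the value by \<open>\<kappa> * \<kappa> = 1\<close>.\<close>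

lemma rep_transpose:
  fixes \<rho> :: "(nat \<Rightarrow> nat) \<Rightarrow> complex"
  assumes r: "r > 0" and rep: "one_dim_rep (2*r*n) (piperm r n) \<rho>"
    and B: "\<And>i. i \<in> {1..n-1} \<Longrightarrow> \<rho> (invB r i) = \<kappa>" and \<kappa>: "\<kappa> * \<kappa> = 1"
    and ab: "a \<in> {1..n}" "b \<in> {1..n}" "a \<noteq> b"
  shows "\<rho> (block_perm (2*r) n (transpose a b) (\<lambda>_. 0)) = \<kappa>"
proof -
  let ?L = "\<lambda>\<sigma>. block_perm (2*r) n \<sigma> (\<lambda>_. 0)"
  have L: "\<rho> (?L (\<sigma> \<circ> \<tau>)) = \<rho> (?L \<sigma>) * \<rho> (?L \<tau>)" if "\<sigma> permutes {1..n}" "\<tau> permutes {1..n}" for \<sigma> \<tau>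
    using one_dim_rep_block_perm_comp[OF r rep that, where e = "\<lambda>_. 0" and f = "\<lambda>_. 0"]
    by (simp only: add_0)
  have tr: "transpose i j permutes {1..n}" if "i \<in> {1..n}" "j \<in> {1..n}" for i j
    using that by (rule permutes_swap_id)
  have adj: "\<rho> (?L (transpose i (Suc i))) = \<kappa>" if "i \<in> {1..n}" "Suc i \<in> {1..n}" for i
    using B[of i] invB_eq_block_perm[OF r, of i n] that by simp
  have "a \<in> {1..n} \<Longrightarrow> Suc (a + k) \<in> {1..n} \<Longrightarrow> \<rho> (?L (transpose a (Suc (a + k)))) = \<kappa>" for a k
  proof (induction k)
    case 0
    then show ?case using adj by simp
  next
    case (Suc k)
    let ?b = "Suc (a + k)"
    have b: "?b \<in> {1..n}" "Suc ?b \<in> {1..n}" using Suc by auto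
    have "transpose a (Suc ?b) = transpose ?b (Suc ?b) \<circ> (transpose a ?b \<circ> transpose ?b (Suc ?b))"
      by (auto simp: fun_eq_iff transpose_def)
    then have "\<rho> (?L (transpose a (Suc ?b))) =
        \<rho> (?L (transpose ?b (Suc ?b))) * (\<rho> (?L (transpose a ?b)) * \<rho> (?L (transpose ?b (Suc ?b))))"
      using L tr b Suc by (simp add: permutes_compose)
    then show ?case using Suc adj[OF b] \<kappa> by simp
  qed
  note * = this
  show ?thesis
  proof (cases "a < b")
    case True
    then show ?thesis using *[of a "b - Suc a"] ab by simp
  next
    case False
    then show ?thesis using *[of b "a - Suc b"] ab by (simp add: transpose_commute)
  qed
qed

text \<open>A block permutation is a pure rotation followed by a pure permutation of blocks. The
  first is built from the cycles A_j, the second from transpositions, whose common value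
  \<open>\<kappa>\<close> squares to 1, so that only the parity counts.\<close>

lemma rep_block_perm:
  fixes \<rho> :: "(nat \<Rightarrow> nat) \<Rightarrow> complex"
  assumes r: "r > 0" and rep: "one_dim_rep (2*r*n) (piperm r n) \<rho>"
    and A: "\<And>j. j \<in> {1..n} \<Longrightarrow> \<rho> (cycA r j) = \<zeta>"
    and B: "\<And>i. i \<in> {1..n-1} \<Longrightarrow> \<rho> (invB r i) = \<kappa>" and \<kappa>: "\<kappa> * \<kappa> = 1"
    and \<sigma>: "\<sigma> permutes {1..n}"
  shows "\<rho> (block_perm (2*r) n \<sigma> e) = (if evenperm \<sigma> then 1 else \<kappa>) * \<zeta> ^ (\<Sum>j\<in>{1..n}. e j)"
proof -
  let ?M = "block_perm (2*r) n"
  have M: "\<rho> (?M (\<sigma> \<circ> \<tau>) (\<lambda>j. f j + e (\<tau> j))) = \<rho> (?M \<sigma> e) * \<rho> (?M \<tau> f)"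
    if "\<sigma> permutes {1..n}" "\<tau> permutes {1..n}" for \<sigma> \<tau> e f
    using one_dim_rep_block_perm_comp[OF r rep that, where e = e and f = f] .
  have id: "id permutes {1..n}" by (rule permutes_id)
  \<comment> \<open>The value is nonzero and equal to its own square.\<close>
  have one: "\<rho> (?M id (\<lambda>_. 0)) = 1"
  proof -
    have "\<rho> (?M id (\<lambda>_. 0)) \<noteq> 0"
      using rep block_perm_in_centralizer[OF r id] unfolding one_dim_rep_def by blast
    then show ?thesis using M[OF id id, of "\<lambda>_. 0" "\<lambda>_. 0"] by (simp only: id_o add_0 mult_cancel_right1 simp_thms)
  qed
  have single: "\<rho> (?M id (\<lambda>i. if i = j then k else 0)) = \<zeta> ^ k" if j: "j \<in> {1..n}" for j k
  proof (induction k)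
    case 0
    have "(\<lambda>i. if i = j then 0 else 0 :: nat) = (\<lambda>_. 0)" by auto
    then show ?case by (simp only: one power_0)
  next
    case (Suc k)
    have "(\<lambda>i. if i = j then Suc k else 0)
        = (\<lambda>i. (if i = j then k else 0) + (if id i = j then 1 else 0))" by auto
    then have "\<rho> (?M id (\<lambda>i. if i = j then Suc k else 0))
        = \<rho> (?M id (\<lambda>i. if i = j then 1 else 0)) * \<rho> (?M id (\<lambda>i. if i = j then k else 0))"
      using M[OF id id, of "\<lambda>i. if i = j then k else 0" "\<lambda>i. if i = j then 1 else 0"]
      by (simp only: id_o)
    also have "\<dots> = \<zeta> * \<zeta> ^ k"
      by (simp only: cycA_eq_block_perm[OF r j, symmetric] A[OF j] Suc)
    finally show ?case by (simp only: power_Suc)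
  qed
  have "\<rho> (?M id (\<lambda>i. if i \<in> J then e i else 0)) = \<zeta> ^ (\<Sum>j\<in>J. e j)"
    if "finite J" "J \<subseteq> {1..n}" for J
    using that
  proof induction
    case empty
    have "(\<lambda>i. if i \<in> {} then e i else 0) = (\<lambda>_. 0)" by auto
    then show ?case by (simp only: one sum.empty power_0)
  next
    case (insert j J)
    have "(\<lambda>i. if i \<in> insert j J then e i else 0)
        = (\<lambda>i. (if i \<in> J then e i else 0) + (if id i = j then e j else 0))"
      using insert by auto
    then have "\<rho> (?M id (\<lambda>i. if i \<in> insert j J then e i else 0))
        = \<rho> (?M id (\<lambda>i. if i = j then e j else 0)) * \<rho> (?M id (\<lambda>i. if i \<in> J then e i else 0))"
      using M[OF id id, of "\<lambda>i. if i \<in> J then e i else 0" "\<lambda>i. if i = j then e j else 0"]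
      by (simp only: id_o)
    also have "\<dots> = \<zeta> ^ e j * \<zeta> ^ (\<Sum>j\<in>J. e j)"
    proof -
      have "j \<in> {1..n}" "J \<subseteq> {1..n}" using insert.prems by blast+
      then show ?thesis by (simp only: single insert.IH)
    qed
    also have "\<dots> = \<zeta> ^ (\<Sum>j\<in>insert j J. e j)"
      using insert by (simp add: power_add)
    finally show ?case .
  qed
  from this[of "{1..n}"] have rho_e: "\<rho> (?M id e) = \<zeta> ^ (\<Sum>j\<in>{1..n}. e j)"
    using block_perm_cong[of n id id "\<lambda>i. if i \<in> {1..n} then e i else 0" e "2*r"] by simp
  have "\<rho> (?M \<sigma> (\<lambda>_. 0)) = (if evenperm \<sigma> then 1 else \<kappa>)"
    using \<sigma> finite_atLeastAtMost[of 1 n]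
  proof (induction rule: permutes_induct)
    case id
    then show ?case using one evenperm_id by metis
  next
    case (swap a b p)
    have perm: "permutation p" by (rule permutes_imp_permutation[OF _ swap(4)]) simp
    have "\<rho> (?M (transpose a b \<circ> p) (\<lambda>_. 0)) = \<rho> (?M (transpose a b) (\<lambda>_. 0)) * \<rho> (?M p (\<lambda>_. 0))"
      using M[OF permutes_swap_id[OF swap(1,2)] swap(4), of "\<lambda>_. 0" "\<lambda>_. 0"] by (simp only: add_0)
    also have "\<dots> = \<kappa> * (if evenperm p then 1 else \<kappa>)"
      using rep_transpose[OF r rep B \<kappa> swap(1-3)] swap(5) by simp
    also have "\<dots> = (if evenperm (transpose a b \<circ> p) then 1 else \<kappa>)"
      using evenperm_comp[OF permutation_swap_id perm, of a b] \<kappa> swap(3) by (simp add: evenperm_swap)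
    finally show ?case .
  qed
  then show ?thesis
    using M[OF \<sigma> id, of e "\<lambda>_. 0"] rho_e by (simp only: add_0_right o_id)
qed

section \<open>Exponents and signs of the two conjugates\<close>

text \<open>If \<open>k\<close> is a unit modulo \<open>d\<close>, then \<open>a\<close> and
  \<open>b\<close> are inverse units, hence equal and odd, and twice an odd number is 2 modulo 2 or
  4. If \<open>k\<close> is 2 modulo 4, then \<open>a\<close> and \<open>b\<close> are odd and both
  sides vanish; \<open>k = 0\<close> is clear. Modulo 8 the claim fails for \<open>k = 1\<close>,
  \<open>a = b = 3\<close>. The proof runs through all residues.\<close>

lemma cong_add_double_of_cong_mult:
  fixes k a b d :: nat
  assumes "d = 2 \<or> d = 4" "[k = k * a * b] (mod d)"
  shows "[k * a + k * b = 2 * k] (mod d)"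
proof -
  define K A B where "K = k mod d" and "A = a mod d" and "B = b mod d"
  have red: "[k = K] (mod d)" "[a = A] (mod d)" "[b = B] (mod d)"
    by (simp_all add: cong_def K_def A_def B_def)
  have "[K * A * B = k * a * b] (mod d)"
    by (intro cong_mult red cong_sym)
  then have KAB: "(K * A * B) mod d = K"
    using assms(2) by (simp add: cong_def K_def)
  have less: "K < d" "A < d" "B < d" using assms(1) by (auto simp: K_def A_def B_def)
  have "[K * A + K * B = 2 * K] (mod d)"
    using assms(1)
  proof
    assume "d = 2"
    moreover from this have "K = 0 \<or> K = 1" "A = 0 \<or> A = 1" "B = 0 \<or> B = 1"
      using less by auto
    ultimately show ?thesis using KAB unfolding cong_def by (elim disjE; simp)
  next
    assume "d = 4"
    moreover from this have "K = 0 \<or> K = 1 \<or> K = 2 \<or> K = 3"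
      "A = 0 \<or> A = 1 \<or> A = 2 \<or> A = 3" "B = 0 \<or> B = 1 \<or> B = 2 \<or> B = 3"
      using less by auto
    ultimately show ?thesis using KAB unfolding cong_def by (elim disjE; simp)
  qed
  moreover have "[k * a + k * b = K * A + K * B] (mod d)" "[2 * k = 2 * K] (mod d)"
    by (intro cong_add cong_mult red cong_refl)+
  ultimately show ?thesis using cong_trans cong_sym by blast
qed

text \<open>
  With \<open>s\<close> the product of the cycles, the assumptions say \<open>x = h\<inverse> s h\<close> and \<open>y = h s h\<inverse>\<close>:
  conjugation by \<open>h\<close> turns the pair \<open>(x, s)\<close> into \<open>(s, y)\<close>, which lets every statement about
  \<open>x\<close> be transferred to \<open>y\<close>.
\<close>
locale conjugate_pair =
  fixes m n :: nat and \<sigma> \<tau> e f h :: "nat \<Rightarrow> nat"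
  assumes m: "m > 0" and \<sigma>: "\<sigma> permutes {1..n}" and \<tau>: "\<tau> permutes {1..n}"
    and h: "h permutes {1..m*n}"
    and h_left: "h \<circ> block_perm m n \<sigma> e = shift m n \<circ> h"
    and h_right: "block_perm m n \<tau> f \<circ> h = h \<circ> shift m n"
begin

abbreviation "X \<equiv> {1..m*n}"
abbreviation "s \<equiv> shift m n"
abbreviation "x \<equiv> block_perm m n \<sigma> e"
abbreviation "y \<equiv> block_perm m n \<tau> f"

text \<open>Multiplying each relation by \<open>inv h\<close> on both sides gives the other relation
  for \<open>inv h\<close>, with the two block permutations exchanged. The interpretation
  \<open>D\<close> below rests on this.\<close>

lemma swapped: "conjugate_pair m n \<tau> \<sigma> f e (inv h)"
proof
  have i: "inv h \<circ> h = id" "h \<circ> inv h = id" using permutes_inv_o[OF h] by auto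
  have "inv h \<circ> y = inv h \<circ> (y \<circ> h) \<circ> inv h" by (simp add: o_assoc[symmetric] i)
  also have "\<dots> = (inv h \<circ> h) \<circ> s \<circ> inv h" unfolding h_right by (simp only: o_assoc)
  finally show "inv h \<circ> y = s \<circ> inv h" by (simp add: i)
  have "x \<circ> inv h = (inv h \<circ> h) \<circ> x \<circ> inv h" by (simp add: i)
  also have "\<dots> = inv h \<circ> (h \<circ> x) \<circ> inv h" by (simp only: o_assoc)
  also have "\<dots> = inv h \<circ> s" unfolding h_left by (simp add: o_assoc[symmetric] i)
  finally show "x \<circ> inv h = inv h \<circ> s" .
qed (use m \<sigma> \<tau> permutes_inv[OF h] in auto)

lemma h_x: "h ((x ^^ a) p) = (s ^^ a) (h p)"
proof -
  have "h (x q) = s (h q)" for q using fun_cong[OF h_left] by simp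
  then show ?thesis by (induction a) auto
qed

lemma h_s: "h ((s ^^ a) p) = (y ^^ a) (h p)"
proof -
  have "h (s q) = y (h q)" for q using fun_cong[OF h_right, of q] by simp
  then show ?thesis by (induction a) auto
qed

lemma s_x: "(s ^^ a) ((x ^^ b) p) = (x ^^ b) ((s ^^ a) p)"
proof -
  have "s (x q) = x (s q)" for q
    using fun_cong[OF block_perm_commutes_shift[OF m \<sigma>, of e], of q] by simp
  then have "s ((x ^^ b) q) = (x ^^ b) (s q)" for q by (induction b) auto
  then show ?thesis by (induction a) auto
qed

lemma s_pow:
  assumes "p \<in> X"
  shows "(s ^^ a) p \<in> X" "block m ((s ^^ a) p) = block m p" "offset m ((s ^^ a) p) = (offset m p + a) mod m"
  using block_perm_mem[of m id n p "\<lambda>_. a"] m assms by (simp_all add: shift_funpow[OF m])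

lemma x_pow:
  assumes "p \<in> X"
  shows "(x ^^ a) p \<in> X" "block m ((x ^^ a) p) = (\<sigma> ^^ a) (block m p)"
    "offset m ((x ^^ a) p) = (offset m p + (\<Sum>l<a. e ((\<sigma> ^^ l) (block m p)))) mod m"
  using block_perm_mem[OF m permutes_image_subset[OF permutes_funpow[OF \<sigma>, of a]] assms]
  by (simp_all add: block_perm_funpow[OF m \<sigma>])

lemma s_pow_eq_iff:
  assumes "p \<in> X"
  shows "(s ^^ a) p = (s ^^ b) p \<longleftrightarrow> [a = b] (mod m)"
proof -
  have "(s ^^ a) p = (s ^^ b) p \<longleftrightarrow> offset m ((s ^^ a) p) = offset m ((s ^^ b) p)"
    using eq_blockI[OF s_pow(1)[OF assms, of a] s_pow(1)[OF assms, of b]] s_pow(2)[OF assms] by auto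
  also have "\<dots> \<longleftrightarrow> [offset m p + a = offset m p + b] (mod m)"
    by (simp add: s_pow(3)[OF assms] cong_def)
  also have "\<dots> \<longleftrightarrow> [a = b] (mod m)" by (rule cong_add_lcancel_nat)
  finally show ?thesis .
qed

lemma same_block:
  assumes "p \<in> X" "q \<in> X" "block m p = block m q"
  obtains a where "q = (s ^^ a) p"
proof -
  \<comment> \<open>The summand \<open>m\<close> keeps the difference of offsets nonnegative and
    vanishes modulo \<open>m\<close>.\<close>
  have "q = (s ^^ (m - offset m p + offset m q)) p"
    by (rule eq_blockI[OF assms(2) s_pow(1)[OF assms(1)]])
       (use offset_less[OF m, of p] offset_less[OF m, of q] in
         \<open>simp_all add: s_pow(2,3)[OF assms(1)] assms(3)\<close>)
  then show thesis using that by blast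
qed

section \<open>Joint orbits of the shift and \<open>x\<close>\<close>

text \<open>This is the orbit of \<open>p\<close> under the group generated by \<open>s\<close> and
  \<open>x\<close>: the two commute and have finite order, so products of nonnegative powers in this
  order suffice.\<close>

definition joint_orbit :: "nat \<Rightarrow> nat set" where
  "joint_orbit p = {(s ^^ a) ((x ^^ b) p) | a b. True}"

lemma permutation_\<sigma>: "permutation \<sigma>"
  using \<sigma> permutation_permutes by blast

lemma joint_orbit_subset: "p \<in> X \<Longrightarrow> joint_orbit p \<subseteq> X"
  using s_pow(1) x_pow(1) by (auto simp: joint_orbit_def simp del: atLeastAtMost_iff)

lemma block_joint_orbit:
  assumes "p \<in> X"
  shows "block m ` joint_orbit p = orbit \<sigma> (block m p)"
proof -
  have "block m ((s ^^ a) ((x ^^ b) p)) = (\<sigma> ^^ b) (block m p)" for a b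
    using s_pow(2)[OF x_pow(1)[OF assms]] x_pow(2)[OF assms] by simp
  then show ?thesis
    unfolding joint_orbit_def orbit_altdef_permutation[OF permutation_\<sigma>]
    by (auto simp: image_iff) metis
qed

text \<open>Powers of \<open>x\<close> reach every block of the \<open>\<sigma>\<close>-orbit, and
  powers of \<open>s\<close> reach every point within a block. Hence joint orbits are unions of
  whole blocks.\<close>

lemma mem_joint_orbit_iff:
  assumes "p \<in> X" "q \<in> X"
  shows "q \<in> joint_orbit p \<longleftrightarrow> block m q \<in> orbit \<sigma> (block m p)"
proof
  assume "block m q \<in> orbit \<sigma> (block m p)"
  then obtain b where "block m q = block m ((x ^^ b) p)"
    unfolding orbit_altdef_permutation[OF permutation_\<sigma>] using x_pow(2)[OF assms(1)] by auto
  then obtain a where "q = (s ^^ a) ((x ^^ b) p)"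
    using same_block[OF x_pow(1)[OF assms(1)] assms(2)] by metis
  then show "q \<in> joint_orbit p" unfolding joint_orbit_def by blast
qed (use block_joint_orbit[OF assms(1)] in blast)

lemma joint_orbit_eq:
  assumes "p \<in> X"
  shows "joint_orbit p = {q \<in> X. block m q \<in> orbit \<sigma> (block m p)}"
  using mem_joint_orbit_iff[OF assms] joint_orbit_subset[OF assms] by blast

lemma card_joint_orbit:
  assumes "p \<in> X"
  shows "card (joint_orbit p) = m * card (orbit \<sigma> (block m p))"
proof -
  have C: "orbit \<sigma> (block m p) \<subseteq> {1..n}"
    using permutes_orbit_subset[OF \<sigma> block_mem[OF assms]] .
  have "bij_betw (\<lambda>(j, q). point m j q) (orbit \<sigma> (block m p) \<times> {..<m}) (joint_orbit p)"
    unfolding bij_betw_def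
  proof
    show "inj_on (\<lambda>(j, q). point m j q) (orbit \<sigma> (block m p) \<times> {..<m})"
    proof (rule inj_onI)
      fix u v
      assume a: "u \<in> orbit \<sigma> (block m p) \<times> {..<m}" "v \<in> orbit \<sigma> (block m p) \<times> {..<m}"
        "(\<lambda>(j, q). point m j q) u = (\<lambda>(j, q). point m j q) v"
      obtain i q j q' where uv: "u = (i, q)" "v = (j, q')" by (cases u; cases v)
      have "i \<in> {1..n}" "j \<in> {1..n}" using a(1,2) C unfolding uv by blast+
      then have "i \<ge> 1" "j \<ge> 1" "q < m" "q' < m" using a(1,2) unfolding uv by simp_all
      moreover have "point m i q = point m j q'" using a(3) unfolding uv by simp
      ultimately show "u = v"
        unfolding uv by (metis block_point offset_point)
    qed
    show "(\<lambda>(j, q). point m j q) ` (orbit \<sigma> (block m p) \<times> {..<m}) = joint_orbit p"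
    proof
      show "(\<lambda>(j, q). point m j q) ` (orbit \<sigma> (block m p) \<times> {..<m}) \<subseteq> joint_orbit p"
        unfolding joint_orbit_eq[OF assms] using point_mem[of _ n _ m] C by fastforce
      show "joint_orbit p \<subseteq> (\<lambda>(j, q). point m j q) ` (orbit \<sigma> (block m p) \<times> {..<m})"
      proof
        fix q assume "q \<in> joint_orbit p"
        then have "q = point m (block m q) (offset m q)" "block m q \<in> orbit \<sigma> (block m p)"
          unfolding joint_orbit_eq[OF assms] by auto
        then show "q \<in> (\<lambda>(j, q). point m j q) ` (orbit \<sigma> (block m p) \<times> {..<m})"
          using offset_less[OF m, of q] by (auto simp: image_iff)
      qed
    qed
  qed
  then have "card (orbit \<sigma> (block m p) \<times> {..<m}) = card (joint_orbit p)" by (rule bij_betw_same_card)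
  then show ?thesis by (simp only: card_cartesian_product card_lessThan mult.commute[of m])
qed

lemma block_X: "block m ` X = {1..n}"
proof
  show "{1..n} \<subseteq> block m ` X"
  proof
    fix j assume j: "j \<in> {1..n}"
    then have "j = block m (point m j 0)" using m by simp
    then show "j \<in> block m ` X" using point_mem[OF j m] by blast
  qed
qed (use block_mem in blast)

lemma orbits_eq: "orbit \<sigma> ` {1..n} = image (block m) ` (joint_orbit ` X)"
  unfolding block_X[symmetric] image_image using block_joint_orbit by (intro image_cong) auto

lemma inj_on_orbits: "inj_on (image (block m)) (joint_orbit ` X)"
proof (rule inj_onI)
  fix U V assume "U \<in> joint_orbit ` X" "V \<in> joint_orbit ` X" and eq: "block m ` U = block m ` V"
  moreover have "W = {z \<in> X. block m z \<in> block m ` W}" if W: "W \<in> joint_orbit ` X" for W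
  proof -
    obtain p where p: "p \<in> X" "W = joint_orbit p" using W by blast
    show ?thesis unfolding p(2) block_joint_orbit[OF p(1)] by (rule joint_orbit_eq[OF p(1)])
  qed
  ultimately show "U = V" by metis
qed

text \<open>The sum over blocks is grouped by joint orbits, because \<open>h\<close> carries joint
  orbits to joint orbits although it need not carry blocks to blocks.\<close>

lemma sum_orbits: "(\<Sum>j\<in>{1..n}. w j) = (\<Sum>U\<in>joint_orbit ` X. \<Sum>j\<in>block m ` U. w j)" for w :: "nat \<Rightarrow> nat"
proof -
  have cyc: "cyclic_on \<sigma> (orbit \<sigma> j)" for j by (rule cyclic_on_orbit'[OF permutation_\<sigma>])
  have "(\<Sum>j\<in>\<Union>(orbit \<sigma> ` {1..n}). w j) = (sum \<circ> sum) w (orbit \<sigma> ` {1..n})"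
  proof (rule sum.Union_disjoint; intro ballI impI)
    fix A assume "A \<in> orbit \<sigma> ` {1..n}"
    then show "finite A" using permutes_orbit_subset[OF \<sigma>] finite_subset by blast
  next
    fix A B assume "A \<in> orbit \<sigma> ` {1..n}" "B \<in> orbit \<sigma> ` {1..n}" "A \<noteq> B"
    then show "A \<inter> B = {}" using orbit_cyclic_eq3[OF cyc] by blast
  qed
  moreover have "\<Union>(orbit \<sigma> ` {1..n}) = {1..n}"
    using permutes_orbit_subset[OF \<sigma>] permutation_self_in_orbit[OF permutation_\<sigma>] by blast
  ultimately show ?thesis
    unfolding orbits_eq by (simp only: o_def sum.reindex[OF inj_on_orbits])
qed

lemma card_orbits: "card (orbit \<sigma> ` {1..n}) = card (joint_orbit ` X)"
  unfolding orbits_eq by (rule card_image[OF inj_on_orbits])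

section \<open>Lengths of the orbits and the first return of \<open>x\<close> to a block\<close>

lemma set_support_eq_orbit: "set (support \<sigma> j) = orbit \<sigma> j"
  unfolding support_set[OF permutation_\<sigma>] orbit_altdef_permutation[OF permutation_\<sigma>] by auto

lemma least_power_eq_card_orbit: "least_power \<sigma> j = card (orbit \<sigma> j)"
  using distinct_card[OF cycle_of_permutation[OF permutation_\<sigma>, of j]] set_support_eq_orbit
  by simp

lemma sum_funpow_eq_sum_orbit:
  "(\<Sum>l<card (orbit \<sigma> j). w ((\<sigma> ^^ l) j)) = (\<Sum>i\<in>orbit \<sigma> j. w i :: nat)"
proof -
  have "(\<Sum>i\<in>orbit \<sigma> j. w i) = sum_list (map w (support \<sigma> j))"
    using sum_list_distinct_conv_sum_set[OF cycle_of_permutation[OF permutation_\<sigma>, of j], of w]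
      set_support_eq_orbit by simp
  also have "\<dots> = (\<Sum>l<card (orbit \<sigma> j). w ((\<sigma> ^^ l) j))"
    unfolding least_power_eq_card_orbit
    by (simp add: o_def sum_list_distinct_conv_sum_set atLeast0LessThan)
  finally show ?thesis by simp
qed

text \<open>After one full turn of the \<open>\<sigma>\<close>-cycle the point is back in its block,
  rotated by the total of the exponents met on the way.\<close>

lemma x_pow_orbit:
  assumes "p \<in> X"
  shows "(x ^^ card (orbit \<sigma> (block m p))) p = (s ^^ (\<Sum>j\<in>orbit \<sigma> (block m p). e j)) p"
proof (rule eq_blockI[OF x_pow(1)[OF assms] s_pow(1)[OF assms]])
  have "(\<sigma> ^^ card (orbit \<sigma> (block m p))) (block m p) = block m p"
    using least_power_of_permutation(1)[OF permutation_\<sigma>] least_power_eq_card_orbit by metis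
  then show "block m ((x ^^ card (orbit \<sigma> (block m p))) p)
      = block m ((s ^^ (\<Sum>j\<in>orbit \<sigma> (block m p). e j)) p)"
    by (simp only: x_pow[OF assms] s_pow[OF assms])
  show "offset m ((x ^^ card (orbit \<sigma> (block m p))) p) = offset m ((s ^^ (\<Sum>j\<in>orbit \<sigma> (block m p). e j)) p)"
    by (simp only: x_pow[OF assms] s_pow[OF assms] sum_funpow_eq_sum_orbit)
qed

text \<open>Powers of \<open>s\<close> stay in the block, so \<open>\<sigma> ^^ a\<close> fixes it,
  and the period of the block under \<open>\<sigma>\<close> divides \<open>a\<close>.\<close>

lemma dvd_of_same_block:
  assumes "p \<in> X" "(x ^^ a) p = (s ^^ b) p"
  shows "card (orbit \<sigma> (block m p)) dvd a"
proof -
  have "(\<sigma> ^^ a) (block m p) = block m p"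
    using x_pow(2)[OF assms(1), of a] s_pow(2)[OF assms(1), of b] assms(2) by simp
  then show ?thesis using least_power_dvd[OF permutation_\<sigma>] least_power_eq_card_orbit by metis
qed

section \<open>Transfer from \<open>x\<close> to \<open>y\<close> along \<open>h\<close>\<close>

lemma h_X: "p \<in> X \<Longrightarrow> h p \<in> X"
  using permutes_in_image[OF h] by blast

interpretation D: conjugate_pair m n \<tau> \<sigma> f e "inv h" by (rule swapped)

lemma joint_orbit_h: "D.joint_orbit (h p) = h ` joint_orbit p"
proof -
  have "h ((s ^^ a) ((x ^^ b) p)) = (s ^^ b) ((y ^^ a) (h p))" for a b
    by (simp only: h_s h_x D.s_x)
  then show ?thesis unfolding joint_orbit_def D.joint_orbit_def by (auto simp: image_iff) metis
qed

lemma joint_orbits_h: "D.joint_orbit ` X = image h ` (joint_orbit ` X)"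
proof -
  have "D.joint_orbit ` X = D.joint_orbit ` (h ` X)" using permutes_image[OF h] by simp
  then show ?thesis by (simp only: image_image joint_orbit_h)
qed

lemma inj_h: "inj h" by (rule permutes_inj[OF h])

lemma inj_on_image_h: "inj_on (image h) A"
  using inj_h by (simp add: inj_image_eq_iff inj_on_def)

lemma sign_eq: "sign \<sigma> = sign \<tau>"
proof -
  have "card (D.joint_orbit ` X) = card (joint_orbit ` X)"
    unfolding joint_orbits_h by (rule card_image[OF inj_on_image_h])
  then show ?thesis
    using sign_card_orbits[OF \<sigma>] sign_card_orbits[OF \<tau>] card_orbits D.card_orbits by simp
qed

text \<open>A joint orbit has \<open>m\<close> points per block, and the bijection \<open>h\<close>
  preserves the number of points.\<close>

lemma card_orbit_h:
  assumes "p \<in> X"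
  shows "card (orbit \<tau> (block m (h p))) = card (orbit \<sigma> (block m p))"
proof -
  have "card (D.joint_orbit (h p)) = card (joint_orbit p)"
    unfolding joint_orbit_h by (rule card_image[OF inj_on_subset[OF inj_h]]) simp
  then show ?thesis using card_joint_orbit[OF assms] D.card_joint_orbit[OF h_X[OF assms]] m by simp
qed

lemma orbit_contribution:
  assumes p: "p \<in> X" and d: "d = 2 \<or> d = 4" "d dvd m"
  shows "[(\<Sum>j\<in>orbit \<sigma> (block m p). e j) + (\<Sum>j\<in>orbit \<tau> (block m (h p)). f j)
           = 2 * card (orbit \<sigma> (block m p))] (mod d)"
proof -
  define k e0 f0 where "k = card (orbit \<sigma> (block m p))" and "e0 = (\<Sum>j\<in>orbit \<sigma> (block m p). e j)"
    and "f0 = (\<Sum>j\<in>orbit \<tau> (block m (h p)). f j)"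
  have xk: "(x ^^ k) p = (s ^^ e0) p" using x_pow_orbit[OF p] by (simp add: k_def e0_def)
  have yk: "(y ^^ k) (h p) = (s ^^ f0) (h p)"
    using D.x_pow_orbit[OF h_X[OF p]] card_orbit_h[OF p] by (simp add: k_def f0_def)
  \<comment> \<open>Both relations are carried across \<open>h\<close>: the one for \<open>y\<close>
    becomes a statement on \<open>x\<close> at \<open>p\<close>, and below the one for
    \<open>x\<close> becomes a statement on \<open>y\<close> at \<open>h p\<close>. Each yields one
    divisibility by \<open>k\<close>.\<close>
  have "h ((s ^^ k) p) = h ((x ^^ f0) p)" using yk by (simp only: h_s h_x)
  then have sk: "(x ^^ f0) p = (s ^^ k) p" using injD[OF inj_h] by metis
  have ye: "(y ^^ e0) (h p) = (s ^^ k) (h p)" using xk by (metis h_s h_x)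
  obtain b where b: "f0 = k * b" using dvd_of_same_block[OF p sk] by (auto simp: k_def)
  obtain a where a: "e0 = k * a"
    using D.dvd_of_same_block[OF h_X[OF p] ye] card_orbit_h[OF p] by (auto simp: k_def)
  have "(x ^^ (k * l)) p = (s ^^ (e0 * l)) p" for l
  proof (induction l)
    case (Suc l)
    have "(x ^^ (k * Suc l)) p = (x ^^ k) ((s ^^ (e0 * l)) p)"
      using Suc by (simp add: funpow_add)
    also have "\<dots> = (s ^^ (e0 * l)) ((s ^^ e0) p)" by (simp only: s_x[symmetric] xk)
    also have "\<dots> = (s ^^ (e0 * Suc l)) p" by (simp add: funpow_add add.commute[of e0])
    finally show ?case .
  qed simp
  \<comment> \<open>This takes \<open>l = b\<close>: the left side is then \<open>x ^^ f0\<close> at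
    \<open>p\<close>, which is \<open>s ^^ k\<close> at \<open>p\<close>.\<close>
  then have "(s ^^ k) p = (s ^^ (k * a * b)) p" using sk a b by metis
  then have "[k = k * a * b] (mod d)"
    using s_pow_eq_iff[OF p] d(2) cong_dvd_modulus_nat by blast
  then have "[k * a + k * b = 2 * k] (mod d)" by (rule cong_add_double_of_cong_mult[OF d(1)])
  then show ?thesis using a b by (simp add: k_def e0_def f0_def)
qed

lemma sum_exponents:
  assumes d: "d = 2 \<or> d = 4" "d dvd m"
  shows "[(\<Sum>j\<in>{1..n}. e j) + (\<Sum>j\<in>{1..n}. f j) = 2 * n] (mod d)"
proof -
  have f: "(\<Sum>j\<in>{1..n}. f j) = (\<Sum>U\<in>joint_orbit ` X. \<Sum>j\<in>block m ` h ` U. f j)"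
    unfolding D.sum_orbits[of f] joint_orbits_h by (simp only: o_def sum.reindex[OF inj_on_image_h])
  have "[(\<Sum>U\<in>joint_orbit ` X. (\<Sum>j\<in>block m ` U. e j) + (\<Sum>j\<in>block m ` h ` U. f j))
      = (\<Sum>U\<in>joint_orbit ` X. 2 * (\<Sum>j\<in>block m ` U. 1 :: nat))] (mod d)"
  proof (rule cong_sum)
    fix U assume "U \<in> joint_orbit ` X"
    then obtain p where p: "p \<in> X" "U = joint_orbit p" by blast
    have "block m ` U = orbit \<sigma> (block m p)" "block m ` h ` U = orbit \<tau> (block m (h p))"
      using block_joint_orbit[OF p(1)] D.block_joint_orbit[OF h_X[OF p(1)]] joint_orbit_h p(2) by metis+
    then show "[(\<Sum>j\<in>block m ` U. e j) + (\<Sum>j\<in>block m ` h ` U. f j) = 2 * (\<Sum>j\<in>block m ` U. 1 :: nat)] (mod d)"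
      using orbit_contribution[OF p(1) d] by simp
  qed
  \<comment> \<open>Written as sums of ones, the orbit lengths add up to \<open>n\<close> by the
    same regrouping.\<close>
  also have "(\<Sum>U\<in>joint_orbit ` X. 2 * (\<Sum>j\<in>block m ` U. 1 :: nat)) = 2 * (\<Sum>j\<in>{1..n}. 1 :: nat)"
    unfolding sum_distrib_left[symmetric] sum_orbits[of "\<lambda>_. 1", symmetric] ..
  finally show ?thesis unfolding f sum_orbits[of e] by (simp add: sum.distrib)
qed

end

section \<open>Negative braidings\<close>

theorem theorem2p16:
  fixes r n c :: nat and \<rho> :: "(nat \<Rightarrow> nat) \<Rightarrow> complex"
    and \<mu> :: "(nat \<Rightarrow> nat) \<Rightarrow> complex"
  assumes "r \<ge> 2" and "n \<ge> 2"
    and "\<mu> = (\<lambda>\<sigma>. 1) \<or> \<mu> = (\<lambda>\<sigma>. of_int (sign \<sigma>))"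
    and "one_dim_rep (2*r*n) (piperm r n) \<rho>"
    and "\<rho> (piperm r n) = -1"
    and "\<forall>j \<in> {1..n}. \<rho> (cycA r j) = cis (pi / real r) ^ c"
    and "\<forall>i \<in> {1..n-1}. \<rho> (invB r i) = \<mu> (Transposition.transpose i (i+1))"
    and "(odd r \<and> c = r) \<or> (even r \<and> c \<in> {r div 2, r, 3 * r div 2})"
  shows "\<forall>gsel. valid_choice (2*r*n) (piperm r n) gsel \<longrightarrow>
           negative_braiding (2*r*n) (piperm r n) \<rho> gsel"
proof (intro allI impI)
  fix gsel assume gsel: "valid_choice (2*r*n) (piperm r n) gsel"
  define \<zeta> where "\<zeta> = cis (pi / real r) ^ c"
  have r: "r > 0" using assms(1) by simp
  let ?s = "piperm r n"
  \<comment> \<open>For \<open>c = r\<close> the root \<open>\<zeta>\<close> is -1 and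
    \<open>d = 2\<close> works. Otherwise \<open>c\<close> is \<open>r/2\<close> or
    \<open>3r/2\<close>, so \<open>\<zeta>\<close> is a primitive fourth root of unity; then
    \<open>r\<close> is even and 4 divides \<open>2*r\<close>.\<close>
  obtain d :: nat where d: "d = 2 \<or> d = 4" "d dvd 2*r" "\<zeta> ^ d = 1"
  proof (cases "c = r")
    case True
    then have "\<zeta> = -1" unfolding \<zeta>_def Complex.DeMoivre using r by simp
    then show thesis using that[of 2] by simp
  next
    case False
    then have "even r" and c: "2 * c = r \<or> 2 * c = 3 * r" using assms(8) by auto
    have "4 * (real c * (pi / real r)) = 2 * pi * real (if 2 * c = r then 1 else 3)"
    proof -
      have "2 * real c = real r \<or> 2 * real c = 3 * real r" using c by linarith
      then show ?thesis using c r by (auto simp: field_simps)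
    qed
    then have "\<zeta> ^ 4 = cis (2 * pi * real (if 2 * c = r then 1 else 3))"
      unfolding \<zeta>_def Complex.DeMoivre by simp
    also have "\<dots> = 1" by (rule cis_multiple_2pi) simp
    finally show thesis using that[of 4] \<open>even r\<close> by (auto elim!: evenE)
  qed
  obtain \<kappa> where \<kappa>: "\<kappa> * \<kappa> = 1" "\<And>i. i \<in> {1..n-1} \<Longrightarrow> \<rho> (invB r i) = \<kappa>"
    using that[of 1] that[of "-1"] assms(3,7) by (auto simp: sign_swap_id)
  have A: "\<And>j. j \<in> {1..n} \<Longrightarrow> \<rho> (cycA r j) = \<zeta>" using assms(6) by (simp add: \<zeta>_def)
  have rho: "\<rho> (block_perm (2*r) n \<sigma> e) = (if evenperm \<sigma> then 1 else \<kappa>) * \<zeta> ^ (\<Sum>j\<in>{1..n}. e j)"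
    if "\<sigma> permutes {1..n}" for \<sigma> e
    using r assms(4) A \<kappa>(2,1) that by (rule rep_block_perm)
  have "\<zeta> ^ n = -1"
    \<comment> \<open>The permutation \<pi> rotates each of the \<open>n\<close> blocks by one and
      fixes all of them as blocks.\<close>
    using rho[OF permutes_id, of "\<lambda>_. 1"] assms(5) by (simp add: piperm_eq_shift[OF r] shift_def evenperm_id)
  then have \<zeta>2n: "\<zeta> ^ (2 * n) = 1" by (simp add: mult.commute[of 2] power_mult)
  show "negative_braiding (2*r*n) ?s \<rho> gsel"
    unfolding negative_braiding_def
  proof (intro ballI impI conjI)
    fix t u assume t: "t \<in> conj_class (2*r*n) ?s" and u: "u \<in> conj_class (2*r*n) ?s"
      and tu: "t \<circ> u = u \<circ> t"
    define g k where "g = gsel t" and "k = gsel u"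
    have g: "g permutes {1..2*r*n}" "g \<circ> ?s \<circ> inv g = t"
      and k: "k permutes {1..2*r*n}" "k \<circ> ?s \<circ> inv k = u"
      using gsel t u by (auto simp: valid_choice_def Sym_def g_def k_def)
    have gi: "inv g \<circ> g = id" "g \<circ> inv g = id" and ki: "inv k \<circ> k = id" "k \<circ> inv k = id"
      using permutes_inv_o g k by auto
    have gi': "inv g (g z) = z" "g (inv g z) = z" and ki': "inv k (k z) = z" "k (inv k z) = z" for z
      using gi ki by (auto simp: fun_eq_iff)
    have s: "?s permutes {1..2*r*n}"
      using block_perm_permutes[of "2*r" id n] r by (simp add: piperm_eq_shift shift_def permutes_id)
    have tp: "t permutes {1..2*r*n}" and up: "u permutes {1..2*r*n}"
      using g k s by (metis permutes_compose permutes_inv)+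
    have T: "t z = g (?s (inv g z))" and U: "u z = k (?s (inv k z))" for z
      using g k by auto
    have TU: "t (u z) = u (t z)" for z using tu by (auto simp: fun_eq_iff)
    show "qcoef \<rho> gsel t t = -1"
    proof -
      have "inv g \<circ> t \<circ> g = ?s" by (auto simp: fun_eq_iff T gi')
      then show ?thesis using assms(5) by (simp add: qcoef_def g_def)
    qed
    \<comment> \<open>The two coefficients are \<open>\<rho> x\<close> and \<open>\<rho> y\<close>.
      Substituting the conjugates for \<open>t\<close> and \<open>u\<close> shows that
      \<open>x\<close> and \<open>y\<close> arise from \<open>?s\<close> by conjugation with
      \<open>inv h\<close> and \<open>h\<close>; that they centralize \<open>?s\<close> is where
      \<open>tu\<close> enters.\<close>
    define h x y where "h = inv g \<circ> k" and "x = inv k \<circ> t \<circ> k" and "y = inv g \<circ> u \<circ> g"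
    have "x \<in> centralizer (2*r*n) ?s"
    proof -
      have "u (k z) = k (?s z)" for z by (simp add: U ki')
      then have "x (?s z) = ?s (x z)" for z
        unfolding x_def by (metis TU U comp_apply ki'(1))
      moreover have "x permutes {1..2*r*n}"
        unfolding x_def by (intro permutes_compose permutes_inv k tp)
      ultimately show ?thesis by (auto simp: centralizer_def Sym_def fun_eq_iff)
    qed
    then obtain \<sigma> e where \<sigma>: "\<sigma> permutes {1..n}" "x = block_perm (2*r) n \<sigma> e"
      by (rule centralizer_eq_block_perm[OF r])
    have "y \<in> centralizer (2*r*n) ?s"
    proof -
      have "t (g z) = g (?s z)" for z by (simp add: T gi')
      then have "y (?s z) = ?s (y z)" for z
        unfolding y_def by (metis TU T comp_apply gi'(1))
      moreover have "y permutes {1..2*r*n}"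
        unfolding y_def by (intro permutes_compose permutes_inv g up)
      ultimately show ?thesis by (auto simp: centralizer_def Sym_def fun_eq_iff)
    qed
    then obtain \<tau> f where \<tau>: "\<tau> permutes {1..n}" "y = block_perm (2*r) n \<tau> f"
      by (rule centralizer_eq_block_perm[OF r])
    interpret P: conjugate_pair "2*r" n \<sigma> \<tau> e f h
    proof
      show "h permutes {1..2*r*n}" unfolding h_def by (intro permutes_compose permutes_inv g k)
      show "h \<circ> block_perm (2*r) n \<sigma> e = shift (2*r) n \<circ> h"
        unfolding \<sigma>(2)[symmetric] piperm_eq_shift[OF r, symmetric]
        by (simp add: fun_eq_iff h_def x_def T gi' ki')
      show "block_perm (2*r) n \<tau> f \<circ> h = h \<circ> shift (2*r) n"
        unfolding \<tau>(2)[symmetric] piperm_eq_shift[OF r, symmetric]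
        by (simp add: fun_eq_iff h_def y_def U gi' ki')
    qed (use r \<sigma> \<tau> in auto)
    have "evenperm \<sigma> = evenperm \<tau>"
      using P.sign_eq by (simp add: sign_def split: if_splits)
    \<comment> \<open>Equal parities make the sign factor occur twice, and it squares to 1.\<close>
    then have "\<rho> x * \<rho> y = \<zeta> ^ ((\<Sum>j\<in>{1..n}. e j) + (\<Sum>j\<in>{1..n}. f j))"
      unfolding \<sigma>(2) \<tau>(2) rho[OF \<sigma>(1)] rho[OF \<tau>(1)] using \<kappa>(1) by (simp add: power_add)
    also have "\<dots> = \<zeta> ^ (2 * n)"
    proof -
      have *: "\<zeta> ^ a = \<zeta> ^ (a mod d)" for a
        using d(3) by (metis mod_mult_div_eq mult_1_right power_add power_mult power_one)
      show ?thesis using P.sum_exponents[OF d(1,2)] unfolding cong_def by (metis *)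
    qed
    finally show "qcoef \<rho> gsel t u * qcoef \<rho> gsel u t = 1"
      by (simp add: qcoef_def x_def y_def g_def k_def \<zeta>2n)
  qed
qed

end
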